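(* Let $\mathbb{K}$ be a field of characteristic zero and $R$ a unital commutative associative $\mathbb{K}$-algebra. If $X,Y\in T_R$ and there exists $c\in R$ satisfying $$[X,Y]=cY,$$ then the bracket $$[\alpha_1,\alpha_2]:=\langle\alpha_1,Y\rangle\pounds_X\alpha_2-\langle\alpha_2,Y\rangle\pounds_X\alpha_1\qquad(\alpha_1,\alpha_2\in\Omega^1_R)$$ gives a Lie-Rinehart algebra structure on $\Omega^1_R$ with the anchor $\rho\colon\Omega^1_R\to T_R$, $\rho(\alpha):=\langle\alpha,Y\rangle X$.
   Context: $T_R:=\mathrm{Der}(R)$ is the $R$-module and Lie algebra (under commutators) of all $\mathbb{K}$-linear derivations $R\to R$; $\Omega^1_R:=\mathrm{Hom}_R(T_R,R)$; $\langle\alpha,X\rangle:=\alpha(X)$ for $\alpha\in\Omega^1_R$, $X\in T_R$. For $X\in T_R$ the Lie derivative $\pounds_X\colon\Omega^1_R\to\Omega^1_R$ is $(\pounds_X\alpha)(Z):=X(\alpha(Z))-\alpha([X,Z])$ for $Z\in T_R$. A Lie-Rinehart algebra structure (equivalently, $(\mathbb{K},R)$-Lie algebra structure) on a unital left $R$-module $L$ with an $R$-linear map $\rho\colon L\to T_R$ (the anchor) is a Lie algebra structure $[\cdot,\cdot]$ on $L$ over $\mathbb{K}$ such that $\rho$ is a Lie algebra homomorphism and $[\ell_1,r\cdot\ell_2]=r\cdot[\ell_1,\ell_2]+(\rho(\ell_1)r)\cdot\ell_2$ for all $r\in R$, $\ell_1,\ell_2\in L$. *)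

theory Defs
  imports "HOL-Algebra.Module"
begin

text \<open>
  Throughout, \<open>K\<close> is the ground ring and \<open>R\<close> is a commutative unital \<open>K\<close>-algebra in the sense of
  the locale \<open>algebra\<close>; since a \<open>module\<close> record extends a \<open>ring\<close> record, \<open>R\<close> also serves
  as the base ring of further modules.
\<close>

definition mod_hom ::
    "('r, 's) ring_scheme \<Rightarrow> ('r, 'a, 'm) module_scheme \<Rightarrow> ('r, 'b, 'n) module_scheme \<Rightarrow> ('a \<Rightarrow> 'b) set"
  where "mod_hom R M N = {f \<in> carrier M \<rightarrow> carrier N.
    (\<forall>x\<in>carrier M. \<forall>y\<in>carrier M. f (x \<oplus>\<^bsub>M\<^esub> y) = f x \<oplus>\<^bsub>N\<^esub> f y) \<and>
    (\<forall>r\<in>carrier R. \<forall>x\<in>carrier M. f (r \<odot>\<^bsub>M\<^esub> x) = r \<odot>\<^bsub>N\<^esub> f x)}"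

text \<open>
  Derivations and linear forms are taken to be extensional functions (\<open>undefined\<close> off their
  domain), so that equality in HOL is equality of maps on the carrier.  The fields \<open>mult\<close> and \<open>one\<close>
  of the records below play no role in a module and are left unspecified.
\<close>

definition derivations :: "('k, 's) ring_scheme \<Rightarrow> ('k, 'r, 'm) module_scheme \<Rightarrow> ('r \<Rightarrow> 'r) set"
  where "derivations K R = {D \<in> carrier R \<rightarrow>\<^sub>E carrier R.
    (\<forall>a\<in>carrier R. \<forall>b\<in>carrier R. D (a \<oplus>\<^bsub>R\<^esub> b) = D a \<oplus>\<^bsub>R\<^esub> D b) \<and>
    (\<forall>k\<in>carrier K. \<forall>a\<in>carrier R. D (k \<odot>\<^bsub>R\<^esub> a) = k \<odot>\<^bsub>R\<^esub> D a) \<and>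
    (\<forall>a\<in>carrier R. \<forall>b\<in>carrier R. D (a \<otimes>\<^bsub>R\<^esub> b) = D a \<otimes>\<^bsub>R\<^esub> b \<oplus>\<^bsub>R\<^esub> a \<otimes>\<^bsub>R\<^esub> D b)}"

definition der_module ::
    "('k, 's) ring_scheme \<Rightarrow> ('k, 'r, 'm) module_scheme \<Rightarrow> ('r, 'r \<Rightarrow> 'r) module"
  where "der_module K R =
    \<lparr>carrier = derivations K R, mult = undefined, one = undefined,
     zero = (\<lambda>a\<in>carrier R. \<zero>\<^bsub>R\<^esub>),
     add = (\<lambda>D E. \<lambda>a\<in>carrier R. D a \<oplus>\<^bsub>R\<^esub> E a),
     smult = (\<lambda>r D. \<lambda>a\<in>carrier R. r \<otimes>\<^bsub>R\<^esub> D a)\<rparr>"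

definition commutator :: "('r, 's) ring_scheme \<Rightarrow> ('r \<Rightarrow> 'r) \<Rightarrow> ('r \<Rightarrow> 'r) \<Rightarrow> 'r \<Rightarrow> 'r"
  where "commutator R D E = (\<lambda>a\<in>carrier R. D (E a) \<ominus>\<^bsub>R\<^esub> E (D a))"

definition ring_as_module :: "('r, 's) ring_scheme \<Rightarrow> ('r, 'r) module"
  where "ring_as_module R =
    \<lparr>carrier = carrier R, mult = mult R, one = one R, zero = zero R, add = add R, smult = mult R\<rparr>"

definition dual_module ::
    "('r, 's) ring_scheme \<Rightarrow> ('r, 'a, 'm) module_scheme \<Rightarrow> ('r, 'a \<Rightarrow> 'r) module"
  where "dual_module R M =
    \<lparr>carrier = mod_hom R M (ring_as_module R) \<inter> extensional (carrier M),
     mult = undefined, one = undefined,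
     zero = (\<lambda>x\<in>carrier M. \<zero>\<^bsub>R\<^esub>),
     add = (\<lambda>\<alpha> \<beta>. \<lambda>x\<in>carrier M. \<alpha> x \<oplus>\<^bsub>R\<^esub> \<beta> x),
     smult = (\<lambda>r \<alpha>. \<lambda>x\<in>carrier M. r \<otimes>\<^bsub>R\<^esub> \<alpha> x)\<rparr>"

text \<open>The module of \<open>1\<close>-forms: \<open>R\<close>-linear forms on the derivations (not Kaehler differentials).\<close>

definition one_forms ::
    "('k, 's) ring_scheme \<Rightarrow> ('k, 'r, 'm) module_scheme \<Rightarrow> ('r, ('r \<Rightarrow> 'r) \<Rightarrow> 'r) module"
  where "one_forms K R = dual_module R (der_module K R)"

definition pairing :: "(('r \<Rightarrow> 'r) \<Rightarrow> 'r) \<Rightarrow> ('r \<Rightarrow> 'r) \<Rightarrow> 'r"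
  where "pairing \<alpha> X = \<alpha> X"

definition lie_derivative ::
    "('k, 's) ring_scheme \<Rightarrow> ('k, 'r, 'm) module_scheme \<Rightarrow> ('r \<Rightarrow> 'r) \<Rightarrow>
     (('r \<Rightarrow> 'r) \<Rightarrow> 'r) \<Rightarrow> ('r \<Rightarrow> 'r) \<Rightarrow> 'r"
  where "lie_derivative K R X \<alpha> =
    (\<lambda>Z\<in>derivations K R. X (\<alpha> Z) \<ominus>\<^bsub>R\<^esub> \<alpha> (commutator R X Z))"

locale lie_algebra = module K V for K (structure) and V (structure) +
  fixes bracket :: "'b \<Rightarrow> 'b \<Rightarrow> 'b"
  assumes bracket_closed:
      "\<lbrakk>x \<in> carrier V; y \<in> carrier V\<rbrakk> \<Longrightarrow> bracket x y \<in> carrier V"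
    and bracket_add_left:
      "\<lbrakk>x \<in> carrier V; y \<in> carrier V; z \<in> carrier V\<rbrakk> \<Longrightarrow>
       bracket (x \<oplus>\<^bsub>V\<^esub> y) z = bracket x z \<oplus>\<^bsub>V\<^esub> bracket y z"
    and bracket_add_right:
      "\<lbrakk>x \<in> carrier V; y \<in> carrier V; z \<in> carrier V\<rbrakk> \<Longrightarrow>
       bracket x (y \<oplus>\<^bsub>V\<^esub> z) = bracket x y \<oplus>\<^bsub>V\<^esub> bracket x z"
    and bracket_smult_left:
      "\<lbrakk>k \<in> carrier K; x \<in> carrier V; y \<in> carrier V\<rbrakk> \<Longrightarrow>
       bracket (k \<odot>\<^bsub>V\<^esub> x) y = k \<odot>\<^bsub>V\<^esub> bracket x y"
    and bracket_smult_right: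
      "\<lbrakk>k \<in> carrier K; x \<in> carrier V; y \<in> carrier V\<rbrakk> \<Longrightarrow>
       bracket x (k \<odot>\<^bsub>V\<^esub> y) = k \<odot>\<^bsub>V\<^esub> bracket x y"
    and bracket_alternating:
      "x \<in> carrier V \<Longrightarrow> bracket x x = \<zero>\<^bsub>V\<^esub>"
    and jacobi:
      "\<lbrakk>x \<in> carrier V; y \<in> carrier V; z \<in> carrier V\<rbrakk> \<Longrightarrow>
       bracket x (bracket y z) \<oplus>\<^bsub>V\<^esub> bracket y (bracket z x) \<oplus>\<^bsub>V\<^esub> bracket z (bracket x y) = \<zero>\<^bsub>V\<^esub>"

definition lie_hom ::
    "('k, 's) ring_scheme \<Rightarrow> ('k, 'a, 'm) module_scheme \<Rightarrow> ('a \<Rightarrow> 'a \<Rightarrow> 'a) \<Rightarrow>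
     ('k, 'b, 'n) module_scheme \<Rightarrow> ('b \<Rightarrow> 'b \<Rightarrow> 'b) \<Rightarrow> ('a \<Rightarrow> 'b) set"
  where "lie_hom K V br W br' = {f \<in> mod_hom K V W.
    \<forall>x\<in>carrier V. \<forall>y\<in>carrier V. f (br x y) = br' (f x) (f y)}"

text \<open>
  An \<open>R\<close>-module is a \<open>K\<close>-module through the structure map of \<open>R\<close>, which sends
  \<open>k\<close> to \<open>k \<odot>\<^bsub>R\<^esub> \<one>\<^bsub>R\<^esub>\<close>.
\<close>

definition restrict_scalars ::
    "('k, 'r, 'm) module_scheme \<Rightarrow> ('r, 'a, 'n) module_scheme \<Rightarrow> ('k, 'a) module"
  where "restrict_scalars R L =
    \<lparr>carrier = carrier L, mult = mult L, one = one L, zero = zero L, add = add L,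
     smult = (\<lambda>k x. (k \<odot>\<^bsub>R\<^esub> \<one>\<^bsub>R\<^esub>) \<odot>\<^bsub>L\<^esub> x)\<rparr>"

locale lie_rinehart_algebra =
  fixes K :: "('k, 's) ring_scheme"
    and R :: "('k, 'r, 'm) module_scheme"
    and L :: "('r, 'l, 'n) module_scheme"
    and bracket :: "'l \<Rightarrow> 'l \<Rightarrow> 'l"
    and anchor :: "'l \<Rightarrow> 'r \<Rightarrow> 'r"
  assumes base_algebra: "algebra K R"
    and module_L: "module R L"
    and lie_L: "lie_algebra K (restrict_scalars R L) bracket"
    and anchor_linear: "anchor \<in> mod_hom R L (der_module K R)"
    and anchor_lie_hom:
      "anchor \<in> lie_hom K (restrict_scalars R L) bracket
         (restrict_scalars R (der_module K R)) (commutator R)"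
    and leibniz:
      "\<lbrakk>r \<in> carrier R; x \<in> carrier L; y \<in> carrier L\<rbrakk> \<Longrightarrow>
       bracket x (r \<odot>\<^bsub>L\<^esub> y) = r \<odot>\<^bsub>L\<^esub> bracket x y \<oplus>\<^bsub>L\<^esub> anchor x r \<odot>\<^bsub>L\<^esub> y"

end

theory Submission
  imports Defs
begin

text \<open>
  The Lie derivative along \<open>X\<close> is a connection on \<open>1\<close>-forms along the derivation \<open>X\<close>: it is additive and
  obeys \<open>\<nabla>(r\<alpha>) = r \<nabla>\<alpha> + X(r) \<alpha>\<close>.  Evaluation at \<open>Y\<close> is a linear form \<open>\<phi>\<close>, and the hypothesis
  \<open>[X,Y] = cY\<close> controls how the two interact: \<open>\<phi>(\<nabla>\<alpha>) = X(\<phi> \<alpha>) - c \<phi>(\<alpha>)\<close>.  The bracket is a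
  Lie-Rinehart structure for these formal reasons, on any module \<open>L\<close> with a connection \<open>\<nabla>\<close> along
  a derivation \<open>D\<close> and a linear form \<open>\<phi>\<close> related in this way (locale \<open>connection_along_derivation\<close>).

  For the bracket \<open>[x,y] = \<phi>(x) \<nabla>y - \<phi>(y) \<nabla>x\<close> and the anchor \<open>x \<mapsto> \<phi>(x) D\<close>, the Leibniz rule is that
  of \<open>\<nabla>\<close>.  The defect \<open>c\<close> contributes the term \<open>c \<phi>(x) \<phi>(y)\<close>, symmetric in \<open>x\<close> and \<open>y\<close>, to both halves of
  \<open>\<phi>[x,y]\<close>, so it cancels and \<open>\<phi>[x,y] = \<phi>(x) D(\<phi> y) - \<phi>(y) D(\<phi> x)\<close> (lemma \<open>phi_br\<close>).  This is the coefficient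
  of \<open>D\<close> in the commutator of \<open>\<phi>(x) D\<close> and \<open>\<phi>(y) D\<close>, so the anchor preserves brackets.  It also gives
  an expansion \<open>[x,[y,z]] = F(x,y,z) - F(x,z,y)\<close> in which \<open>F\<close> is a sum of two functions, each symmetric
  under a transposition of its arguments; the Jacobi sum is the sum of \<open>F\<close> over even permutations minus
  that over odd ones, and hence vanishes (lemma \<open>br_jacobi\<close>).
\<close>

section \<open>Modules of ring-valued functions\<close>

text \<open>
  Derivations and linear forms are both sets of \<open>R\<close>-valued functions closed under the pointwise
  operations, and they inherit the module laws from \<open>R\<close> for that reason alone;
  negatives are the multiples by \<open>-1\<close>.
\<close>

lemma module_of_functions:
  fixes R (structure)
  assumes "cring R"
    and sub: "S \<subseteq> A \<rightarrow>\<^sub>E carrier R"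
    and zero: "(\<lambda>x\<in>A. \<zero>) \<in> S"
    and add: "\<And>f g. \<lbrakk>f \<in> S; g \<in> S\<rbrakk> \<Longrightarrow> (\<lambda>x\<in>A. f x \<oplus> g x) \<in> S"
    and smult: "\<And>r f. \<lbrakk>r \<in> carrier R; f \<in> S\<rbrakk> \<Longrightarrow> (\<lambda>x\<in>A. r \<otimes> f x) \<in> S"
  shows "module R \<lparr>carrier = S, mult = m, one = e, zero = (\<lambda>x\<in>A. \<zero>),
     add = (\<lambda>f g. \<lambda>x\<in>A. f x \<oplus> g x), smult = (\<lambda>r f. \<lambda>x\<in>A. r \<otimes> f x)\<rparr>" (is "module R ?M")
proof -
  interpret cring R by fact
  have cl: "f x \<in> carrier R" if "f \<in> S" "x \<in> A" for f x
    using that sub by (blast dest: PiE_mem)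
  have ext: "f \<in> extensional A" if "f \<in> S" for f
    using that sub by (auto simp: PiE_def)
  have restr: "(\<lambda>x\<in>A. f x) = f" if "f \<in> S" for f
    using ext[OF that] by (rule extensional_restrict)
  have "abelian_group ?M"
  proof (rule abelian_groupI)
    fix f assume f: "f \<in> carrier ?M"
    then have "(\<lambda>x\<in>A. (\<ominus> \<one>) \<otimes> f x) \<in> S"
      by (auto intro: smult)
    moreover have "(\<lambda>x\<in>A. (\<lambda>x\<in>A. (\<ominus> \<one>) \<otimes> f x) x \<oplus> f x) = (\<lambda>x\<in>A. \<zero>)"
      using f by (auto simp: cl l_minus l_neg intro!: restrict_ext)
    ultimately show "\<exists>g\<in>carrier ?M. g \<oplus>\<^bsub>?M\<^esub> f = \<zero>\<^bsub>?M\<^esub>"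
      by (intro bexI[of _ "\<lambda>x\<in>A. (\<ominus> \<one>) \<otimes> f x"]) (simp_all only: partial_object.simps ring.simps)
  qed (auto simp: zero add cl a_assoc intro!: restrict_ext a_comm,
       auto simp: cl restr cong: restrict_cong)
  then show ?thesis
    using \<open>cring R\<close>
    by (intro moduleI)
      (auto simp: smult cl l_distr r_distr m_assoc intro!: restrict_ext,
       auto simp: cl restr cong: restrict_cong)
qed

lemma module_restrict_scalars:
  assumes "algebra K R" and "module R L"
  shows "module K (restrict_scalars R L)"
proof -
  interpret A: algebra K R by fact
  interpret L: module R L by fact
  have lin: "k \<odot>\<^bsub>R\<^esub> r = (k \<odot>\<^bsub>R\<^esub> \<one>\<^bsub>R\<^esub>) \<otimes>\<^bsub>R\<^esub> r" if "k \<in> carrier K" "r \<in> carrier R" for k r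
    using that by (simp add: A.smult_assoc2)
  have "abelian_group (restrict_scalars R L)"
    by (rule abelian_groupI)
      (auto simp: restrict_scalars_def L.M.a_ac intro!: bexI[of _ "\<ominus>\<^bsub>L\<^esub> _"] L.M.l_neg)
  then show ?thesis
    by (intro moduleI A.R.is_cring)
      (auto simp: restrict_scalars_def A.smult_l_distr L.smult_l_distr L.smult_r_distr
        A.smult_assoc1 L.smult_assoc1[symmetric] lin[symmetric])
qed

section \<open>Differences in abelian groups\<close>

context abelian_group
begin

lemma diff_add_diff:
  "\<lbrakk>x \<in> carrier G; y \<in> carrier G; z \<in> carrier G; w \<in> carrier G\<rbrakk> \<Longrightarrow>
   (x \<ominus> y) \<oplus> (z \<ominus> w) = (x \<oplus> z) \<ominus> (y \<oplus> w)"
  by (simp add: minus_eq minus_add a_ac)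

lemma add_diff_add_cancel:
  "\<lbrakk>x \<in> carrier G; y \<in> carrier G; z \<in> carrier G\<rbrakk> \<Longrightarrow> (x \<oplus> z) \<ominus> (y \<oplus> z) = x \<ominus> y"
  by (simp add: diff_add_diff[symmetric]) (simp add: minus_eq r_neg)

end

lemma additive_diff:
  assumes "abelian_group G" and "abelian_group H"
    and closed: "\<And>x. x \<in> carrier G \<Longrightarrow> f x \<in> carrier H"
    and add: "\<And>x y. \<lbrakk>x \<in> carrier G; y \<in> carrier G\<rbrakk> \<Longrightarrow> f (x \<oplus>\<^bsub>G\<^esub> y) = f x \<oplus>\<^bsub>H\<^esub> f y"
    and x: "x \<in> carrier G" and y: "y \<in> carrier G"
  shows "f (x \<ominus>\<^bsub>G\<^esub> y) = f x \<ominus>\<^bsub>H\<^esub> f y"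
proof -
  interpret G: abelian_group G by fact
  interpret H: abelian_group H by fact
  have "f x = f (x \<ominus>\<^bsub>G\<^esub> y) \<oplus>\<^bsub>H\<^esub> f y"
    using add[of "x \<ominus>\<^bsub>G\<^esub> y" y] x y by (simp add: G.minus_eq G.a_assoc G.l_neg)
  then show ?thesis
    using x y by (simp add: closed H.minus_eq H.a_assoc H.r_neg)
qed

section \<open>Derivations\<close>

locale base_algebra = algebra K R for K and R (structure)
begin

lemma derivation_closed: "\<lbrakk>D \<in> derivations K R; a \<in> carrier R\<rbrakk> \<Longrightarrow> D a \<in> carrier R"
  by (auto simp: derivations_def)

lemma derivation_add:
  "\<lbrakk>D \<in> derivations K R; a \<in> carrier R; b \<in> carrier R\<rbrakk> \<Longrightarrow> D (a \<oplus> b) = D a \<oplus> D b"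
  by (auto simp: derivations_def)

lemma derivation_smult:
  "\<lbrakk>D \<in> derivations K R; k \<in> carrier K; a \<in> carrier R\<rbrakk> \<Longrightarrow> D (k \<odot> a) = k \<odot> D a"
  by (auto simp: derivations_def)

lemma derivation_mult:
  "\<lbrakk>D \<in> derivations K R; a \<in> carrier R; b \<in> carrier R\<rbrakk> \<Longrightarrow> D (a \<otimes> b) = D a \<otimes> b \<oplus> a \<otimes> D b"
  by (auto simp: derivations_def)

text \<open>Since \<open>1\<cdot>1 = 1\<close>, the Leibniz rule forces \<open>D 1 = D 1 + D 1\<close>.\<close>

lemma derivation_scalar:
  assumes "D \<in> derivations K R" "k \<in> carrier K"
  shows "D (k \<odot> \<one>) = \<zero>"
proof -
  have "D \<one> \<oplus> D \<one> = D \<one>"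
    using derivation_mult[OF assms(1), of \<one> \<one>] assms by (simp add: derivation_closed)
  then have "D \<one> = \<zero>"
    using assms M.add.r_cancel_one' derivation_closed by (metis one_closed)
  then show ?thesis
    using assms by (simp add: derivation_smult)
qed

lemma module_derivations: "module R (der_module K R)"
  unfolding der_module_def
proof (rule module_of_functions)
  show "cring R" by (rule M_cring)
next
  fix D E assume D: "D \<in> derivations K R" and E: "E \<in> derivations K R"
  show "(\<lambda>a\<in>carrier R. D a \<oplus> E a) \<in> derivations K R"
    unfolding derivations_def
    by (auto simp: D[THEN derivation_closed] E[THEN derivation_closed] D[THEN derivation_add]
        E[THEN derivation_add] D[THEN derivation_smult] E[THEN derivation_smult]
        D[THEN derivation_mult] E[THEN derivation_mult] smult_r_distr l_distr r_distr M.a_ac)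
next
  fix r D assume r: "r \<in> carrier R" and D: "D \<in> derivations K R"
  have "r \<otimes> (k \<odot> a) = k \<odot> (r \<otimes> a)" if "k \<in> carrier K" "a \<in> carrier R" for k a
    using that r smult_assoc2[of k a r] by (simp add: m_comm)
  then show "(\<lambda>a\<in>carrier R. r \<otimes> D a) \<in> derivations K R"
    unfolding derivations_def
    by (auto simp: r D[THEN derivation_closed] D[THEN derivation_add] D[THEN derivation_smult]
        D[THEN derivation_mult] r_distr m_ac)
qed (auto simp: derivations_def)

lemma commutator_derivation:
  assumes D: "D \<in> derivations K R" and E: "E \<in> derivations K R"
  shows "commutator R D E \<in> derivations K R"
proof -
  note d = D[THEN derivation_closed] E[THEN derivation_closed]
    D[THEN derivation_add] E[THEN derivation_add] D[THEN derivation_smult]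
    E[THEN derivation_smult] D[THEN derivation_mult] E[THEN derivation_mult]
  have "D (E (a \<otimes> b)) \<ominus> E (D (a \<otimes> b)) =
      (D (E a) \<ominus> E (D a)) \<otimes> b \<oplus> a \<otimes> (D (E b) \<ominus> E (D b))"
    if ab: "a \<in> carrier R" "b \<in> carrier R" for a b
  proof -
    \<comment> \<open>The mixed terms form a sum that is symmetric in \<open>D\<close> and \<open>E\<close>, so they cancel.\<close>
    let ?s = "D a \<otimes> E b \<oplus> E a \<otimes> D b"
    have "D (E (a \<otimes> b)) = (D (E a) \<otimes> b \<oplus> a \<otimes> D (E b)) \<oplus> ?s"
      using ab by (simp add: d M.a_ac)
    moreover have "E (D (a \<otimes> b)) = (E (D a) \<otimes> b \<oplus> a \<otimes> E (D b)) \<oplus> ?s"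
      using ab by (simp add: d M.a_ac)
    ultimately have "D (E (a \<otimes> b)) \<ominus> E (D (a \<otimes> b)) =
        (D (E a) \<otimes> b \<oplus> a \<otimes> D (E b)) \<ominus> (E (D a) \<otimes> b \<oplus> a \<otimes> E (D b))"
      using ab by (simp only:) (rule M.add_diff_add_cancel, simp_all add: d)
    then show ?thesis
      using ab by (simp add: d l_distr r_distr M.minus_eq l_minus r_minus M.minus_add M.a_ac)
  qed
  then show ?thesis
    unfolding derivations_def
    by (auto simp: commutator_def d M.diff_add_diff)
      (simp add: d M.minus_eq smult_r_distr smult_r_minus)
qed

lemma commutator_add_right:
  assumes "D \<in> derivations K R" "E \<in> derivations K R" "F \<in> derivations K R"
  shows "commutator R D (E \<oplus>\<^bsub>der_module K R\<^esub> F) =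
    commutator R D E \<oplus>\<^bsub>der_module K R\<^esub> commutator R D F"
  using assms
  by (auto simp: commutator_def der_module_def derivation_closed derivation_add
      M.diff_add_diff intro!: restrict_ext)

text \<open>
  The commutator is not linear over \<open>R\<close>; in the Lie derivative of a linear form \<open>\<alpha>\<close> the extra term
  cancels the one that the Leibniz rule produces in \<open>D (r \<otimes> \<alpha> E)\<close>.
\<close>

lemma commutator_smult_right:
  assumes D: "D \<in> derivations K R" and E: "E \<in> derivations K R" and r: "r \<in> carrier R"
  shows "commutator R D (r \<odot>\<^bsub>der_module K R\<^esub> E) =
    r \<odot>\<^bsub>der_module K R\<^esub> commutator R D E \<oplus>\<^bsub>der_module K R\<^esub> D r \<odot>\<^bsub>der_module K R\<^esub> E"
  using assms
  by (auto simp: commutator_def der_module_def derivation_closed derivation_mult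
      M.minus_eq r_distr r_minus M.a_ac intro!: restrict_ext)

end

section \<open>Forms and the Lie derivative\<close>

lemma module_dual:
  assumes "module R M"
  shows "module R (dual_module R M)"
proof -
  interpret module R M by fact
  show ?thesis
    unfolding dual_module_def
  proof (rule module_of_functions)
    show "cring R" by (rule R.is_cring)
  qed (auto simp: mod_hom_def ring_as_module_def R.a_ac R.r_distr R.m_ac PiE_def Pi_iff)
qed

context base_algebra
begin

abbreviation "forms \<equiv> carrier (one_forms K R)"

lemma module_forms: "module R (one_forms K R)"
  unfolding one_forms_def by (intro module_dual module_derivations)

lemma forms_iff:
  "\<alpha> \<in> forms \<longleftrightarrow> \<alpha> \<in> derivations K R \<rightarrow>\<^sub>E carrier R \<and>
    (\<forall>Z\<in>derivations K R. \<forall>W\<in>derivations K R. \<alpha> (Z \<oplus>\<^bsub>der_module K R\<^esub> W) = \<alpha> Z \<oplus> \<alpha> W) \<and>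
    (\<forall>r\<in>carrier R. \<forall>Z\<in>derivations K R. \<alpha> (r \<odot>\<^bsub>der_module K R\<^esub> Z) = r \<otimes> \<alpha> Z)"
  by (auto simp: one_forms_def dual_module_def mod_hom_def ring_as_module_def der_module_def PiE_def)

lemma form_closed: "\<lbrakk>\<alpha> \<in> forms; Z \<in> derivations K R\<rbrakk> \<Longrightarrow> \<alpha> Z \<in> carrier R"
  by (auto simp: forms_iff)

lemma form_add:
  "\<lbrakk>\<alpha> \<in> forms; Z \<in> derivations K R; W \<in> derivations K R\<rbrakk> \<Longrightarrow>
   \<alpha> (Z \<oplus>\<^bsub>der_module K R\<^esub> W) = \<alpha> Z \<oplus> \<alpha> W"
  by (auto simp: forms_iff)

lemma form_smult:
  "\<lbrakk>\<alpha> \<in> forms; r \<in> carrier R; Z \<in> derivations K R\<rbrakk> \<Longrightarrow>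
   \<alpha> (r \<odot>\<^bsub>der_module K R\<^esub> Z) = r \<otimes> \<alpha> Z"
  by (auto simp: forms_iff)

lemma derivations_add:
  "\<lbrakk>Z \<in> derivations K R; W \<in> derivations K R\<rbrakk> \<Longrightarrow> Z \<oplus>\<^bsub>der_module K R\<^esub> W \<in> derivations K R"
  using abelian_monoid.a_closed[OF abelian_group.axioms(1)[OF module.axioms(2)[OF module_derivations]]]
  by (simp add: der_module_def)

lemma derivations_smult:
  "\<lbrakk>r \<in> carrier R; Z \<in> derivations K R\<rbrakk> \<Longrightarrow> r \<odot>\<^bsub>der_module K R\<^esub> Z \<in> derivations K R"
  using module.smult_closed[OF module_derivations] by (simp add: der_module_def)

lemma lie_derivative_closed:
  assumes X: "X \<in> derivations K R" and \<alpha>: "\<alpha> \<in> forms"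
  shows "lie_derivative K R X \<alpha> \<in> forms"
proof -
  note cl = X[THEN derivation_closed] \<alpha>[THEN form_closed] commutator_derivation[OF X]
    derivations_add derivations_smult
  have add: "X (\<alpha> (Z \<oplus>\<^bsub>der_module K R\<^esub> W)) \<ominus> \<alpha> (commutator R X (Z \<oplus>\<^bsub>der_module K R\<^esub> W)) =
      (X (\<alpha> Z) \<ominus> \<alpha> (commutator R X Z)) \<oplus> (X (\<alpha> W) \<ominus> \<alpha> (commutator R X W))"
    if "Z \<in> derivations K R" "W \<in> derivations K R" for Z W
    using that X \<alpha>
    by (simp add: cl form_add derivation_add commutator_add_right M.diff_add_diff)
  have smult: "X (\<alpha> (r \<odot>\<^bsub>der_module K R\<^esub> Z)) \<ominus> \<alpha> (commutator R X (r \<odot>\<^bsub>der_module K R\<^esub> Z)) =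
      r \<otimes> (X (\<alpha> Z) \<ominus> \<alpha> (commutator R X Z))"
    if Z: "Z \<in> derivations K R" and r: "r \<in> carrier R" for r Z
  proof -
    \<comment> \<open>Both terms contribute \<open>X r \<otimes> \<alpha> Z\<close>, which cancels.\<close>
    have "X (\<alpha> (r \<odot>\<^bsub>der_module K R\<^esub> Z)) = r \<otimes> X (\<alpha> Z) \<oplus> X r \<otimes> \<alpha> Z"
      using Z r X \<alpha> by (simp add: cl form_smult derivation_mult M.a_ac)
    moreover have "\<alpha> (commutator R X (r \<odot>\<^bsub>der_module K R\<^esub> Z)) =
        r \<otimes> \<alpha> (commutator R X Z) \<oplus> X r \<otimes> \<alpha> Z"
      using Z r X \<alpha> by (simp add: cl form_smult form_add commutator_smult_right)
    ultimately show ?thesis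
      using Z r by (simp add: cl M.add_diff_add_cancel) (simp add: cl M.minus_eq r_distr r_minus)
  qed
  show ?thesis
    unfolding forms_iff using add smult
    by (auto simp: lie_derivative_def cl)
qed

lemma lie_derivative_add:
  assumes "X \<in> derivations K R" "\<alpha> \<in> forms" "\<beta> \<in> forms"
  shows "lie_derivative K R X (\<alpha> \<oplus>\<^bsub>one_forms K R\<^esub> \<beta>) =
    lie_derivative K R X \<alpha> \<oplus>\<^bsub>one_forms K R\<^esub> lie_derivative K R X \<beta>"
  using assms
  by (auto simp: lie_derivative_def one_forms_def dual_module_def der_module_def
      commutator_derivation derivation_closed derivation_add M.diff_add_diff
      form_closed[unfolded one_forms_def dual_module_def der_module_def]
      intro!: restrict_ext)

lemma lie_derivative_smult:
  assumes "X \<in> derivations K R" "r \<in> carrier R" "\<alpha> \<in> forms"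
  shows "lie_derivative K R X (r \<odot>\<^bsub>one_forms K R\<^esub> \<alpha>) =
    r \<odot>\<^bsub>one_forms K R\<^esub> lie_derivative K R X \<alpha> \<oplus>\<^bsub>one_forms K R\<^esub> X r \<odot>\<^bsub>one_forms K R\<^esub> \<alpha>"
  using assms
  by (auto simp: lie_derivative_def one_forms_def dual_module_def der_module_def
      commutator_derivation derivation_closed derivation_mult
      form_closed[unfolded one_forms_def dual_module_def der_module_def]
      M.minus_eq r_distr r_minus M.a_ac intro!: restrict_ext)

end

section \<open>Lie-Rinehart structures from a connection along one derivation\<close>

text \<open>
  The prototype is \<open>L = \<Omega>\<^sup>1\<close>, with \<open>nabla\<close> the Lie derivative along \<open>D\<close> and \<open>\<phi>\<close> the evaluation at a
  derivation whose commutator with \<open>D\<close> is \<open>c\<close> times itself.  The last axiom says that \<open>\<phi>\<close> is an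
  eigenvector with eigenvalue \<open>c\<close> of the dual connection, which takes \<open>\<phi>\<close> to
  \<open>\<lambda>x. D (\<phi> x) \<ominus> \<phi> (nabla x)\<close>.
\<close>

locale connection_along_derivation = base_algebra K R + L: module R L
  for K :: "('k, 's) ring_scheme" and R :: "('k, 'r, 'm) module_scheme" (structure)
    and L :: "('r, 'l, 'n) module_scheme" +
  fixes D :: "'r \<Rightarrow> 'r" and nabla :: "'l \<Rightarrow> 'l" and \<phi> :: "'l \<Rightarrow> 'r" and c :: 'r
  assumes D: "D \<in> derivations K R"
    and nabla_closed: "x \<in> carrier L \<Longrightarrow> nabla x \<in> carrier L"
    and nabla_add: "\<lbrakk>x \<in> carrier L; y \<in> carrier L\<rbrakk> \<Longrightarrow> nabla (x \<oplus>\<^bsub>L\<^esub> y) = nabla x \<oplus>\<^bsub>L\<^esub> nabla y"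
    and nabla_smult: "\<lbrakk>r \<in> carrier R; x \<in> carrier L\<rbrakk> \<Longrightarrow>
      nabla (r \<odot>\<^bsub>L\<^esub> x) = r \<odot>\<^bsub>L\<^esub> nabla x \<oplus>\<^bsub>L\<^esub> D r \<odot>\<^bsub>L\<^esub> x"
    and phi_closed: "x \<in> carrier L \<Longrightarrow> \<phi> x \<in> carrier R"
    and phi_add: "\<lbrakk>x \<in> carrier L; y \<in> carrier L\<rbrakk> \<Longrightarrow> \<phi> (x \<oplus>\<^bsub>L\<^esub> y) = \<phi> x \<oplus> \<phi> y"
    and phi_smult: "\<lbrakk>r \<in> carrier R; x \<in> carrier L\<rbrakk> \<Longrightarrow> \<phi> (r \<odot>\<^bsub>L\<^esub> x) = r \<otimes> \<phi> x"
    and c: "c \<in> carrier R"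
    and phi_nabla: "x \<in> carrier L \<Longrightarrow> \<phi> (nabla x) = D (\<phi> x) \<ominus> c \<otimes> \<phi> x"
begin

definition br :: "'l \<Rightarrow> 'l \<Rightarrow> 'l"
  where "br x y = \<phi> x \<odot>\<^bsub>L\<^esub> nabla y \<ominus>\<^bsub>L\<^esub> \<phi> y \<odot>\<^bsub>L\<^esub> nabla x"

lemmas closed = nabla_closed phi_closed D[THEN derivation_closed]

lemma br_closed: "\<lbrakk>x \<in> carrier L; y \<in> carrier L\<rbrakk> \<Longrightarrow> br x y \<in> carrier L"
  by (simp add: br_def closed)

lemma br_antisym: "\<lbrakk>x \<in> carrier L; y \<in> carrier L\<rbrakk> \<Longrightarrow> br x y = \<ominus>\<^bsub>L\<^esub> br y x"
  by (simp add: br_def closed L.M.minus_eq L.M.minus_add L.M.a_ac)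

lemma br_add_right:
  "\<lbrakk>x \<in> carrier L; y \<in> carrier L; z \<in> carrier L\<rbrakk> \<Longrightarrow> br x (y \<oplus>\<^bsub>L\<^esub> z) = br x y \<oplus>\<^bsub>L\<^esub> br x z"
  by (simp add: br_def closed nabla_add phi_add L.smult_l_distr L.smult_r_distr L.M.diff_add_diff)

lemma br_smult_right:
  assumes "r \<in> carrier R" "x \<in> carrier L" "y \<in> carrier L"
  shows "br x (r \<odot>\<^bsub>L\<^esub> y) = r \<odot>\<^bsub>L\<^esub> br x y \<oplus>\<^bsub>L\<^esub> (\<phi> x \<otimes> D r) \<odot>\<^bsub>L\<^esub> y"
  using assms
  by (simp add: br_def closed nabla_smult phi_smult L.smult_r_distr L.smult_r_minus
      L.smult_assoc1[symmetric] m_ac L.M.minus_eq L.M.a_ac)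

lemma nabla_diff:
  "\<lbrakk>x \<in> carrier L; y \<in> carrier L\<rbrakk> \<Longrightarrow> nabla (x \<ominus>\<^bsub>L\<^esub> y) = nabla x \<ominus>\<^bsub>L\<^esub> nabla y"
  by (rule additive_diff[OF L.abelian_group_axioms L.abelian_group_axioms])
    (simp_all add: nabla_closed nabla_add)

lemma phi_diff:
  "\<lbrakk>x \<in> carrier L; y \<in> carrier L\<rbrakk> \<Longrightarrow> \<phi> (x \<ominus>\<^bsub>L\<^esub> y) = \<phi> x \<ominus> \<phi> y"
  by (rule additive_diff[OF L.abelian_group_axioms M.abelian_group_axioms])
    (simp_all add: phi_closed phi_add)

text \<open>
  The only place where the eigenvector property of \<open>\<phi>\<close> enters: \<open>c\<close> drops out, so \<open>\<phi>\<close> carries the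
  bracket to the one that makes \<open>a \<mapsto> a D\<close> compatible with commutators.
\<close>

lemma phi_br:
  assumes "x \<in> carrier L" "y \<in> carrier L"
  shows "\<phi> (br x y) = \<phi> x \<otimes> D (\<phi> y) \<ominus> \<phi> y \<otimes> D (\<phi> x)"
proof -
  let ?s = "\<ominus> (c \<otimes> \<phi> x \<otimes> \<phi> y)"
  have "\<phi> x \<otimes> \<phi> (nabla y) = \<phi> x \<otimes> D (\<phi> y) \<oplus> ?s" "\<phi> y \<otimes> \<phi> (nabla x) = \<phi> y \<otimes> D (\<phi> x) \<oplus> ?s"
    using assms c by (simp_all add: phi_nabla closed M.minus_eq r_distr r_minus m_ac)
  then show ?thesis
    using assms c by (simp add: br_def phi_diff phi_smult closed M.add_diff_add_cancel)
qed

text \<open>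
  In \<open>br x (br y z)\<close> the second-order part \<open>A\<close> is symmetric in its first two arguments, while the
  first-order part \<open>B\<close>, once the term that comes from \<open>\<phi> (br y z)\<close> is grouped with the one that comes
  from differentiating the coefficient \<open>\<phi> y\<close>, is symmetric in its first and last.  A function symmetric
  under a transposition has the same sum over the even permutations of \<open>x, y, z\<close> as over the odd ones.
\<close>

lemma br_jacobi:
  assumes x: "x \<in> carrier L" and y: "y \<in> carrier L" and z: "z \<in> carrier L"
  shows "br x (br y z) \<oplus>\<^bsub>L\<^esub> br y (br z x) \<oplus>\<^bsub>L\<^esub> br z (br x y) = \<zero>\<^bsub>L\<^esub>"
proof -
  define A where "A u v w = (\<phi> u \<otimes> \<phi> v) \<odot>\<^bsub>L\<^esub> nabla (nabla w)" for u v w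
  define B where "B u v w =
    (\<phi> u \<otimes> D (\<phi> v)) \<odot>\<^bsub>L\<^esub> nabla w \<oplus>\<^bsub>L\<^esub> (\<phi> w \<otimes> D (\<phi> v)) \<odot>\<^bsub>L\<^esub> nabla u" for u v w
  have cl: "A u v w \<in> carrier L" "B u v w \<in> carrier L"
    if "u \<in> carrier L" "v \<in> carrier L" "w \<in> carrier L" for u v w
    using that by (simp_all add: A_def B_def closed)
  have expand: "br u (br v w) = (A u v w \<oplus>\<^bsub>L\<^esub> B u v w) \<ominus>\<^bsub>L\<^esub> (A u w v \<oplus>\<^bsub>L\<^esub> B u w v)"
    if "u \<in> carrier L" "v \<in> carrier L" "w \<in> carrier L" for u v w
  proof -
    have "nabla (br v w) = (\<phi> v \<odot>\<^bsub>L\<^esub> nabla (nabla w) \<oplus>\<^bsub>L\<^esub> D (\<phi> v) \<odot>\<^bsub>L\<^esub> nabla w)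
        \<ominus>\<^bsub>L\<^esub> (\<phi> w \<odot>\<^bsub>L\<^esub> nabla (nabla v) \<oplus>\<^bsub>L\<^esub> D (\<phi> w) \<odot>\<^bsub>L\<^esub> nabla v)"
      using that by (simp add: br_def nabla_diff nabla_smult closed)
    then show ?thesis
      unfolding br_def[of u "br v w"]
      using that
      by (simp add: phi_br A_def B_def closed L.M.minus_eq M.minus_eq L.smult_r_distr
          L.smult_l_distr L.smult_r_minus L.smult_l_minus L.M.minus_add L.smult_assoc1[symmetric]
          L.M.a_ac)
  qed
  have sym: "A u v w = A v u w" "B u v w = B w v u"
    if "u \<in> carrier L" "v \<in> carrier L" "w \<in> carrier L" for u v w
    using that by (simp_all add: A_def B_def closed m_comm L.M.a_comm)
  show ?thesis
    using x y z
    by (simp add: expand cl L.M.diff_add_diff sym[of x z y] sym[of y x z] sym[of z y x])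
      (simp add: cl L.M.a_ac L.M.minus_eq L.M.r_neg)
qed

theorem lie_rinehart:
  "lie_rinehart_algebra K R L br (\<lambda>x. \<phi> x \<odot>\<^bsub>der_module K R\<^esub> D)"
proof -
  interpret KL: module K "restrict_scalars R L"
    by (intro module_restrict_scalars algebra_axioms L.module_axioms)
  \<comment> \<open>Linearity over \<open>K\<close> is the Leibniz rule for coefficients that \<open>D\<close> kills.\<close>
  have scalar: "br x ((k \<odot> \<one>) \<odot>\<^bsub>L\<^esub> y) = (k \<odot> \<one>) \<odot>\<^bsub>L\<^esub> br x y"
    if "k \<in> carrier K" "x \<in> carrier L" "y \<in> carrier L" for k x y
    using that by (simp add: br_smult_right derivation_scalar[OF D] closed br_closed)
  have lie: "lie_algebra K (restrict_scalars R L) br"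
  proof
    fix x y z k
    assume x: "x \<in> carrier (restrict_scalars R L)" and y: "y \<in> carrier (restrict_scalars R L)"
    note xy = x[unfolded restrict_scalars_def, simplified] y[unfolded restrict_scalars_def, simplified]
    show "br x y \<in> carrier (restrict_scalars R L)"
      using xy by (simp add: restrict_scalars_def br_closed)
    show "br x x = \<zero>\<^bsub>restrict_scalars R L\<^esub>"
      using xy by (simp add: restrict_scalars_def br_def closed L.M.minus_eq L.M.r_neg)
    {
      assume k: "k \<in> carrier K"
      show "br x (k \<odot>\<^bsub>restrict_scalars R L\<^esub> y) = k \<odot>\<^bsub>restrict_scalars R L\<^esub> br x y"
        using xy k by (simp add: restrict_scalars_def scalar)
      show "br (k \<odot>\<^bsub>restrict_scalars R L\<^esub> x) y = k \<odot>\<^bsub>restrict_scalars R L\<^esub> br x y"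
        using xy k
        by (simp add: restrict_scalars_def br_antisym[of _ y] scalar br_closed L.smult_r_minus)
    }
    assume "z \<in> carrier (restrict_scalars R L)"
    then have z: "z \<in> carrier L" by (simp add: restrict_scalars_def)
    show "br x (y \<oplus>\<^bsub>restrict_scalars R L\<^esub> z) =
        br x y \<oplus>\<^bsub>restrict_scalars R L\<^esub> br x z"
      using xy z by (simp add: restrict_scalars_def br_add_right)
    show "br (x \<oplus>\<^bsub>restrict_scalars R L\<^esub> y) z =
        br x z \<oplus>\<^bsub>restrict_scalars R L\<^esub> br y z"
      using xy z
      by (simp add: restrict_scalars_def br_antisym[of _ z] br_add_right br_closed L.M.minus_add)
    show "br x (br y z) \<oplus>\<^bsub>restrict_scalars R L\<^esub> br y (br z x) \<oplus>\<^bsub>restrict_scalars R L\<^esub> br z (br x y)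
        = \<zero>\<^bsub>restrict_scalars R L\<^esub>"
      using xy z by (simp add: restrict_scalars_def br_jacobi)
  qed
  have anchor_closed: "\<phi> x \<odot>\<^bsub>der_module K R\<^esub> D \<in> derivations K R" if "x \<in> carrier L" for x
    using that by (simp add: derivations_smult D closed)
  have linear: "(\<lambda>x. \<phi> x \<odot>\<^bsub>der_module K R\<^esub> D) \<in> mod_hom R L (der_module K R)"
    using anchor_closed
    by (auto simp: mod_hom_def der_module_def phi_add phi_smult closed l_distr m_assoc
        intro!: restrict_ext)
  have scalars: "\<phi> ((k \<odot> \<one>) \<odot>\<^bsub>L\<^esub> x) \<odot>\<^bsub>der_module K R\<^esub> D =
      (k \<odot> \<one>) \<odot>\<^bsub>der_module K R\<^esub> (\<phi> x \<odot>\<^bsub>der_module K R\<^esub> D)"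
    if "k \<in> carrier K" "x \<in> carrier L" for k x
    using linear that by (auto simp: mod_hom_def)
  have comm: "\<phi> (br x y) \<odot>\<^bsub>der_module K R\<^esub> D =
      commutator R (\<phi> x \<odot>\<^bsub>der_module K R\<^esub> D) (\<phi> y \<odot>\<^bsub>der_module K R\<^esub> D)"
    if xy: "x \<in> carrier L" "y \<in> carrier L" for x y
  proof -
    have "\<phi> (br x y) \<otimes> D a = \<phi> x \<otimes> D (\<phi> y \<otimes> D a) \<ominus> \<phi> y \<otimes> D (\<phi> x \<otimes> D a)"
      if a: "a \<in> carrier R" for a
    proof -
      \<comment> \<open>The second-order term is symmetric in \<open>x\<close> and \<open>y\<close>, so it cancels in the commutator.\<close>
      let ?s = "\<phi> x \<otimes> \<phi> y \<otimes> D (D a)"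
      have "\<phi> x \<otimes> D (\<phi> y \<otimes> D a) = \<phi> x \<otimes> D (\<phi> y) \<otimes> D a \<oplus> ?s"
        "\<phi> y \<otimes> D (\<phi> x \<otimes> D a) = \<phi> y \<otimes> D (\<phi> x) \<otimes> D a \<oplus> ?s"
        using xy a by (simp_all add: derivation_mult[OF D] closed r_distr m_ac M.a_comm)
      then show ?thesis
        using xy a by (simp add: phi_br closed M.add_diff_add_cancel)
          (simp add: closed M.minus_eq l_distr l_minus)
    qed
    then show ?thesis
      by (auto simp: commutator_def der_module_def closed xy intro!: restrict_ext)
  qed
  show ?thesis
  proof (rule lie_rinehart_algebra.intro)
    show "algebra K R" by (rule algebra_axioms)
    show "module R L" by (rule L.module_axioms)
    show "lie_algebra K (restrict_scalars R L) br" by (rule lie)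
    show "(\<lambda>x. \<phi> x \<odot>\<^bsub>der_module K R\<^esub> D) \<in> mod_hom R L (der_module K R)" by (rule linear)
    show "(\<lambda>x. \<phi> x \<odot>\<^bsub>der_module K R\<^esub> D) \<in> lie_hom K (restrict_scalars R L) br
        (restrict_scalars R (der_module K R)) (commutator R)"
      using linear comm scalars
      by (auto simp: lie_hom_def mod_hom_def restrict_scalars_def)
  next
    fix r x y assume "r \<in> carrier R" "x \<in> carrier L" "y \<in> carrier L"
    then show "br x (r \<odot>\<^bsub>L\<^esub> y) =
        r \<odot>\<^bsub>L\<^esub> br x y \<oplus>\<^bsub>L\<^esub> (\<phi> x \<odot>\<^bsub>der_module K R\<^esub> D) r \<odot>\<^bsub>L\<^esub> y"
      by (simp add: br_smult_right der_module_def)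
  qed
qed

end

section \<open>The bracket on one-forms\<close>

theorem corollary4p13:
  fixes K :: "('k, 's) ring_scheme"
    and R :: "('k, 'r, 'm) module_scheme"
    and X Y :: "'r \<Rightarrow> 'r"
  assumes "field K"
    and "\<And>n::nat. 0 < n \<Longrightarrow> [n] \<cdot>\<^bsub>K\<^esub> \<one>\<^bsub>K\<^esub> \<noteq> \<zero>\<^bsub>K\<^esub>"
    and "algebra K R"
    and "X \<in> carrier (der_module K R)"
    and "Y \<in> carrier (der_module K R)"
    and "\<exists>c\<in>carrier R. commutator R X Y = c \<odot>\<^bsub>der_module K R\<^esub> Y"
  shows "lie_rinehart_algebra K R (one_forms K R)
    (\<lambda>\<alpha>\<^sub>1 \<alpha>\<^sub>2.
       pairing \<alpha>\<^sub>1 Y \<odot>\<^bsub>one_forms K R\<^esub> lie_derivative K R X \<alpha>\<^sub>2 \<ominus>\<^bsub>one_forms K R\<^esub>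
       pairing \<alpha>\<^sub>2 Y \<odot>\<^bsub>one_forms K R\<^esub> lie_derivative K R X \<alpha>\<^sub>1)
    (\<lambda>\<alpha>. pairing \<alpha> Y \<odot>\<^bsub>der_module K R\<^esub> X)"
proof -
  interpret base_algebra K R using assms(3) by (rule base_algebra.intro)
  have X: "X \<in> derivations K R" and Y: "Y \<in> derivations K R"
    using assms(4,5) by (simp_all add: der_module_def)
  obtain c where c: "c \<in> carrier R" and XY: "commutator R X Y = c \<odot>\<^bsub>der_module K R\<^esub> Y"
    using assms(6) by blast
  interpret C: connection_along_derivation K R "one_forms K R" X "lie_derivative K R X"
    "\<lambda>\<alpha>. pairing \<alpha> Y" c
  proof (rule connection_along_derivation.intro)
    show "connection_along_derivation_axioms K R (one_forms K R) X (lie_derivative K R X)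
        (\<lambda>\<alpha>. pairing \<alpha> Y) c"
    proof
      fix \<alpha> assume \<alpha>: "\<alpha> \<in> forms"
      show "lie_derivative K R X \<alpha> \<in> forms"
        using X \<alpha> by (rule lie_derivative_closed)
      show "pairing \<alpha> Y \<in> carrier R"
        using \<alpha> Y by (simp add: pairing_def form_closed)
      show "pairing (lie_derivative K R X \<alpha>) Y = X (pairing \<alpha> Y) \<ominus>\<^bsub>R\<^esub> c \<otimes>\<^bsub>R\<^esub> pairing \<alpha> Y"
        using \<alpha> Y c by (simp add: pairing_def lie_derivative_def XY form_smult)
      {
        fix \<beta> assume \<beta>: "\<beta> \<in> forms"
        show "lie_derivative K R X (\<alpha> \<oplus>\<^bsub>one_forms K R\<^esub> \<beta>) =
            lie_derivative K R X \<alpha> \<oplus>\<^bsub>one_forms K R\<^esub> lie_derivative K R X \<beta>"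
          using X \<alpha> \<beta> by (rule lie_derivative_add)
        show "pairing (\<alpha> \<oplus>\<^bsub>one_forms K R\<^esub> \<beta>) Y = pairing \<alpha> Y \<oplus>\<^bsub>R\<^esub> pairing \<beta> Y"
          using Y by (simp add: pairing_def one_forms_def dual_module_def der_module_def)
      }
      fix r assume r: "r \<in> carrier R"
      show "lie_derivative K R X (r \<odot>\<^bsub>one_forms K R\<^esub> \<alpha>) =
          r \<odot>\<^bsub>one_forms K R\<^esub> lie_derivative K R X \<alpha> \<oplus>\<^bsub>one_forms K R\<^esub> X r \<odot>\<^bsub>one_forms K R\<^esub> \<alpha>"
        using X r \<alpha> by (rule lie_derivative_smult)
      show "pairing (r \<odot>\<^bsub>one_forms K R\<^esub> \<alpha>) Y = r \<otimes>\<^bsub>R\<^esub> pairing \<alpha> Y"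
        using Y by (simp add: pairing_def one_forms_def dual_module_def der_module_def)
    qed (rule X c)+
  qed (rule base_algebra_axioms module_forms)+
  show ?thesis
    using C.lie_rinehart unfolding C.br_def[abs_def] .
qed

end
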